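(* Let $E$ be a finite-dimensional real vector space, $Q\subset E$ nonempty, convex and compact, and $h:Q\to\mathbb{R}$ concave and differentiable on $Q$, with finite curvature constant $C_{h,Q}$. Run the Frank-Wolfe method initiated with the pre-start step from a point $\lambda_0\in Q$ (which corresponds to $\bar\alpha_0=1$), and then with step-sizes $\bar\alpha_i=\frac{1}{i+1}$ for $i\ge1$. Then for all $k\ge0$: $$B_k-h(\lambda_{k+1})\le\frac{\frac12C_{h,Q}(1+\ln(k+1))}{k+1},$$ and for all $k\ge2$: $$\min_{i\in\{1,\ldots,k\}}G_i\le\frac{\frac34C_{h,Q}\left(2.3+2\ln(k)\right)}{k-1}.$$
   Context: Notation: $E^*$ is the dual space of $E$, $s^T\lambda$ is the evaluation of $s\in E^*$ at $\lambda\in E$, $\nabla h(\lambda)\in E^*$, and $h^*=\max_{\lambda\in Q}h(\lambda)$. Curvature constant: $C_{h,Q}$ is the minimal $C$ such that $h(\lambda+\alpha(\bar\lambda-\lambda))\ge h(\lambda)+\nabla h(\lambda)^T(\alpha(\bar\lambda-\lambda))-\frac12 C\alpha^2$ for all $\lambda,\bar\lambda\in Q$ and all $\alpha\in[0,1]$ (assumed finite). Pre-start step: given $\lambda_0\in Q$ and an upper bound $B_{-1}\ge h^*$ (possibly $+\infty$), choose $\tilde\lambda_0\in\arg\max_{\lambda\in Q}\{h(\lambda_0)+\nabla h(\lambda_0)^T(\lambda-\lambda_0)\}$, set $B^w_0=h(\lambda_0)+\nabla h(\lambda_0)^T(\tilde\lambda_0-\lambda_0)$, $B_0=\min\{B_{-1},B^w_0,B^o_0\}$,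 and $\lambda_1=\tilde\lambda_0$. Frank-Wolfe method: at iteration $k\ge1$, choose $\tilde\lambda_k\in\arg\max_{\lambda\in Q}\{h(\lambda_k)+\nabla h(\lambda_k)^T(\lambda-\lambda_k)\}$; set $B^w_k=h(\lambda_k)+\nabla h(\lambda_k)^T(\tilde\lambda_k-\lambda_k)$ and the FW gap $G_k=\nabla h(\lambda_k)^T(\tilde\lambda_k-\lambda_k)$; set $B_k=\min\{B_{k-1},B^w_k,B^o_k\}$; set $\lambda_{k+1}=\lambda_k+\bar\alpha_k(\tilde\lambda_k-\lambda_k)$. Here each $B^o_k\ge h^*$ ($k\ge0$) is any other (optional) upper bound on $h^*$ (omitted, or $+\infty$, if not computed). *)

theory Defs
  imports "HOL-Analysis.Analysis"
begin

text \<open>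
  The dual space of \<open>'a\<close> is \<open>'a \<Rightarrow>\<^sub>L real\<close>; in finite dimension every linear functional is
  bounded. The set \<open>Q\<close> may have empty interior, and then a derivative within \<open>Q\<close> is not unique
  as a functional. For convex \<open>Q\<close> its values on the directions \<open>y - x\<close> with \<open>y \<in> Q\<close> are
  unique, and the curvature, the linear models on \<open>Q\<close> and the gaps depend on these only.
\<close>

definition is_gradient_on ::
    "'a::real_normed_vector set \<Rightarrow> ('a \<Rightarrow> real) \<Rightarrow> ('a \<Rightarrow> 'a \<Rightarrow>\<^sub>L real) \<Rightarrow> bool" where
  "is_gradient_on Q h dh \<longleftrightarrow>
     (\<forall>x\<in>Q. (h has_derivative blinfun_apply (dh x)) (at x within Q))"

definition curvature_bound ::
    "'a::real_normed_vector set \<Rightarrow> ('a \<Rightarrow> real) \<Rightarrow> ('a \<Rightarrow> 'a \<Rightarrow>\<^sub>L real) \<Rightarrow> real \<Rightarrow> bool" where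
  "curvature_bound Q h dh C \<longleftrightarrow>
     (\<forall>x\<in>Q. \<forall>y\<in>Q. \<forall>\<alpha>\<in>{0..1}.
        h (x + \<alpha> *\<^sub>R (y - x)) \<ge>
          h x + blinfun_apply (dh x) (\<alpha> *\<^sub>R (y - x)) - 1/2 * C * \<alpha>\<^sup>2)"

definition finite_curvature ::
    "'a::real_normed_vector set \<Rightarrow> ('a \<Rightarrow> real) \<Rightarrow> ('a \<Rightarrow> 'a \<Rightarrow>\<^sub>L real) \<Rightarrow> bool" where
  "finite_curvature Q h dh \<longleftrightarrow> (\<exists>C. curvature_bound Q h dh C)"

text \<open>
  The least bound exists when \<open>Q\<close> is nonempty and the curvature is finite: the bounds form a
  closed set, and the case \<open>x = y\<close>, \<open>\<alpha> = 1\<close> makes each of them nonnegative.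
\<close>

definition curvature_const ::
    "'a::real_normed_vector set \<Rightarrow> ('a \<Rightarrow> real) \<Rightarrow> ('a \<Rightarrow> 'a \<Rightarrow>\<^sub>L real) \<Rightarrow> real" where
  "curvature_const Q h dh = (LEAST C. curvature_bound Q h dh C)"

definition opt_value :: "'a set \<Rightarrow> ('a \<Rightarrow> real) \<Rightarrow> real" where
  "opt_value Q h = (SUP x\<in>Q. h x)"

definition lin_model ::
    "('a::real_normed_vector \<Rightarrow> real) \<Rightarrow> ('a \<Rightarrow> 'a \<Rightarrow>\<^sub>L real) \<Rightarrow> 'a \<Rightarrow> 'a \<Rightarrow> real" where
  "lin_model h dh x y = h x + blinfun_apply (dh x) (y - x)"

definition fw_gap ::
    "('a::real_normed_vector \<Rightarrow> 'a \<Rightarrow>\<^sub>L real) \<Rightarrow> (nat \<Rightarrow> 'a) \<Rightarrow> (nat \<Rightarrow> 'a) \<Rightarrow> nat \<Rightarrow> real" where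
  "fw_gap dh lam lamt k = blinfun_apply (dh (lam k)) (lamt k - lam k)"

definition wolfe_bound ::
    "('a::real_normed_vector \<Rightarrow> real) \<Rightarrow> ('a \<Rightarrow> 'a \<Rightarrow>\<^sub>L real) \<Rightarrow>
     (nat \<Rightarrow> 'a) \<Rightarrow> (nat \<Rightarrow> 'a) \<Rightarrow> nat \<Rightarrow> real" where
  "wolfe_bound h dh lam lamt k = lin_model h dh (lam k) (lamt k)"

text \<open>
  \<open>Binit\<close> is the bound with index \<open>-1\<close>. The bounds \<open>Binit\<close> and \<open>Bo k\<close> are extended reals, so
  that an omitted one is \<open>\<infinity>\<close>.
\<close>

fun best_bound ::
    "('a::real_normed_vector \<Rightarrow> real) \<Rightarrow> ('a \<Rightarrow> 'a \<Rightarrow>\<^sub>L real) \<Rightarrow>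
     (nat \<Rightarrow> 'a) \<Rightarrow> (nat \<Rightarrow> 'a) \<Rightarrow> ereal \<Rightarrow> (nat \<Rightarrow> ereal) \<Rightarrow> nat \<Rightarrow> ereal" where
  "best_bound h dh lam lamt Binit Bo 0 =
     min Binit (min (ereal (wolfe_bound h dh lam lamt 0)) (Bo 0))"
| "best_bound h dh lam lamt Binit Bo (Suc k) =
     min (best_bound h dh lam lamt Binit Bo k)
       (min (ereal (wolfe_bound h dh lam lamt (Suc k))) (Bo (Suc k)))"

definition fw_prestart ::
    "'a::real_normed_vector set \<Rightarrow> ('a \<Rightarrow> real) \<Rightarrow> ('a \<Rightarrow> 'a \<Rightarrow>\<^sub>L real) \<Rightarrow>
     (nat \<Rightarrow> 'a) \<Rightarrow> (nat \<Rightarrow> 'a) \<Rightarrow> bool" where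
  "fw_prestart Q h dh lam lamt \<longleftrightarrow>
     lam 0 \<in> Q \<and>
     is_arg_max (lin_model h dh (lam 0)) (\<lambda>y. y \<in> Q) (lamt 0) \<and>
     lam 1 = lamt 0"

definition fw_method ::
    "'a::real_normed_vector set \<Rightarrow> ('a \<Rightarrow> real) \<Rightarrow> ('a \<Rightarrow> 'a \<Rightarrow>\<^sub>L real) \<Rightarrow>
     (nat \<Rightarrow> real) \<Rightarrow> (nat \<Rightarrow> 'a) \<Rightarrow> (nat \<Rightarrow> 'a) \<Rightarrow> bool" where
  "fw_method Q h dh \<alpha> lam lamt \<longleftrightarrow>
     (\<forall>k\<ge>1. is_arg_max (lin_model h dh (lam k)) (\<lambda>y. y \<in> Q) (lamt k) \<and>
             lam (k + 1) = lam k + \<alpha> k *\<^sub>R (lamt k - lam k))"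

end

theory Submission
  imports Defs
begin

text \<open>
  The curvature inequality and \<open>B\<^sub>k \<le> h(\<lambda>\<^sub>k) + G\<^sub>k\<close> give
  \<open>(k+1) (B\<^sub>k - h(\<lambda>\<^sub>k\<^sub>+\<^sub>1)) \<le> k (B\<^sub>k\<^sub>-\<^sub>1 - h(\<lambda>\<^sub>k)) + C/(2(k+1))\<close>, and the harmonic sum yields the
  first bound. For the gaps, the curvature inequality is summed over \<open>m \<le> i \<le> k\<close> with
  \<open>m = \<lfloor>k/2\<rfloor>\<close>: the first bound at \<open>m - 1\<close> controls the possible increase of \<open>h\<close> after step \<open>m\<close>,
  while the step-sizes in this range add up to at least \<open>ln 2\<close>.
\<close>

section \<open>Attainment of the curvature constant, and upper bounds on the optimal value\<close>

lemma curvature_const_is_bound: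
  assumes ne: "Q \<noteq> {}" and fin: "finite_curvature Q h dh"
  shows "curvature_bound Q h dh (curvature_const Q h dh)" (is ?bound)
    and "0 \<le> curvature_const Q h dh" (is ?nonneg)
proof -
  let ?S = "{C. curvature_bound Q h dh C}"
  have nonneg: "0 \<le> C" if "curvature_bound Q h dh C" for C
  proof -
    obtain x where "x \<in> Q" using ne by blast
    with that have "h (x + 1 *\<^sub>R (x - x)) \<ge>
        h x + blinfun_apply (dh x) (1 *\<^sub>R (x - x)) - 1/2 * C * 1\<^sup>2"
      unfolding curvature_bound_def by (metis atLeastAtMost_iff order_refl zero_le_one)
    then show ?thesis by simp
  qed
  \<comment> \<open>For fixed points and step length, the condition is a non-strict inequality
    affine in \<open>C\<close>. The set of bounds is thus an intersection of closed sets and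
    contains its infimum.\<close>
  have "?S = (\<Inter>x\<in>Q. \<Inter>y\<in>Q. \<Inter>a\<in>{0..1}. {C.
      h x + blinfun_apply (dh x) (a *\<^sub>R (y - x)) - 1/2 * C * a\<^sup>2 \<le> h (x + a *\<^sub>R (y - x))})"
    unfolding curvature_bound_def by blast
  also have "closed \<dots>"
    by (intro closed_INT ballI closed_Collect_le continuous_intros)
  finally have "closed ?S" .
  moreover have "?S \<noteq> {}" using fin by (auto simp: finite_curvature_def)
  moreover have bdd: "bdd_below ?S" by (rule bdd_belowI[of _ 0]) (use nonneg in simp)
  ultimately have "Inf ?S \<in> ?S" by (intro closed_contains_Inf)
  moreover have "curvature_const Q h dh = Inf ?S"
    unfolding curvature_const_def using \<open>Inf ?S \<in> ?S\<close> bdd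
    by (intro Least_equality) (auto intro: cInf_lower)
  ultimately show ?bound by simp
  then show ?nonneg by (rule nonneg)
qed

text \<open>Only a derivative within \<open>Q\<close> is given, so \<open>h\<close> is restricted to
  the segment from \<open>x\<close> to \<open>y\<close>. There the difference quotients at
  \<open>0\<close> tend to \<open>d (y - x)\<close>, and concavity keeps each of them above
  \<open>h y - h x\<close>.\<close>

lemma concave_on_below_tangent:
  fixes h :: "'a::real_normed_vector \<Rightarrow> real"
  assumes conc: "concave_on Q h" and der: "(h has_derivative d) (at x within Q)"
    and x: "x \<in> Q" and y: "y \<in> Q"
  shows "h y \<le> h x + d (y - x)"
proof -
  let ?g = "\<lambda>t::real. x + t *\<^sub>R (y - x)"
  have "convex Q" using conc by (rule concave_on_imp_convex)
  then have line: "?g ` {0..1} \<subseteq> Q"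
    using x y by (auto simp: convex_alt algebra_simps)
  have lin: "d (t *\<^sub>R (y - x)) = t * d (y - x)" for t
    using der has_derivative_linear linear_cmul by fastforce
  have "(?g has_derivative (\<lambda>t. t *\<^sub>R (y - x))) (at 0 within {0..1})"
    by (auto intro!: derivative_eq_intros)
  moreover have "(h has_derivative d) (at (?g 0) within ?g ` {0..1})"
    using der line by (simp add: has_derivative_subset)
  ultimately have "(h \<circ> ?g has_derivative d \<circ> (\<lambda>t. t *\<^sub>R (y - x))) (at 0 within {0..1})"
    by (rule diff_chain_within)
  then have "((\<lambda>t. h (?g t)) has_field_derivative d (y - x)) (at 0 within {0..1})"
    by (simp add: has_field_derivative_def o_def lin mult_commute_abs)
  then have "((\<lambda>t. (h (?g t) - h x) / t) \<longlongrightarrow> d (y - x)) (at 0 within {0..1})"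
    by (simp add: has_field_derivative_iff)
  moreover have "\<forall>\<^sub>F t in at 0 within {0..1}. h y - h x \<le> (h (?g t) - h x) / t"
    unfolding eventually_at_filter
  proof (intro always_eventually allI impI)
    fix t :: real assume t: "t \<noteq> 0" "t \<in> {0..1}"
    then have "(1 - t) * h x + t * h y \<le> h ((1 - t) *\<^sub>R x + t *\<^sub>R y)"
      using conc x y unfolding concave_on_iff by auto
    moreover have "(1 - t) *\<^sub>R x + t *\<^sub>R y = ?g t" by (simp add: algebra_simps)
    ultimately have "(h y - h x) * t \<le> h (?g t) - h x" by (simp add: algebra_simps)
    with t show "h y - h x \<le> (h (?g t) - h x) / t" by (simp add: pos_le_divide_eq)
  qed
  moreover have "at (0::real) within {0..1} \<noteq> bot"
    by (simp add: at_within_Icc_at_right)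
  ultimately have "h y - h x \<le> d (y - x)" by (intro tendsto_lowerbound)
  then show ?thesis by simp
qed

lemma le_opt_value:
  assumes "compact Q" "is_gradient_on Q h dh" "x \<in> Q"
  shows "h x \<le> opt_value Q h"
proof -
  have "continuous_on Q h"
    using assms(2) unfolding is_gradient_on_def
    by (meson continuous_on_eq_continuous_within has_derivative_continuous)
  then have "bdd_above (h ` Q)"
    by (meson assms(1) bounded_imp_bdd_above compact_continuous_image compact_imp_bounded)
  with assms(3) show ?thesis unfolding opt_value_def by (intro cSUP_upper)
qed

text \<open>The tangent model at \<open>lam k\<close> dominates \<open>h\<close> on
  \<open>Q\<close>, and \<open>lamt k\<close> maximizes this model.\<close>

lemma opt_value_le_wolfe_bound:
  assumes "concave_on Q h" "is_gradient_on Q h dh" "Q \<noteq> {}" "lam k \<in> Q"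
    and "is_arg_max (lin_model h dh (lam k)) (\<lambda>y. y \<in> Q) (lamt k)"
  shows "opt_value Q h \<le> wolfe_bound h dh lam lamt k"
  unfolding opt_value_def
proof (rule cSUP_least[OF assms(3)])
  fix y assume y: "y \<in> Q"
  have "h y \<le> lin_model h dh (lam k) y"
    unfolding lin_model_def
    by (rule concave_on_below_tangent[OF assms(1) _ assms(4) y])
       (use assms(2,4) in \<open>auto simp: is_gradient_on_def\<close>)
  also have "\<dots> \<le> wolfe_bound h dh lam lamt k"
    using assms(5) y unfolding is_arg_max_def wolfe_bound_def by (auto simp: not_less)
  finally show "h y \<le> wolfe_bound h dh lam lamt k" .
qed

lemma fw_iterates_in_set:
  assumes "convex Q" "fw_prestart Q h dh lam lamt" "fw_method Q h dh \<alpha> lam lamt"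
    and "\<And>i. i \<ge> 1 \<Longrightarrow> \<alpha> i \<in> {0..1}"
  shows "lam k \<in> Q"
proof (induction k)
  case 0
  show ?case using assms(2) by (simp add: fw_prestart_def)
next
  case (Suc k)
  show ?case
  proof (cases "k = 0")
    case True
    then show ?thesis using assms(2) by (simp add: fw_prestart_def is_arg_max_def)
  next
    case False
    then have "lamt k \<in> Q" "lam (Suc k) = (1 - \<alpha> k) *\<^sub>R lam k + \<alpha> k *\<^sub>R lamt k"
      using assms(3) by (auto simp: fw_method_def is_arg_max_def algebra_simps)
    with Suc assms(1) assms(4)[of k] False show ?thesis by (auto simp: convex_alt)
  qed
qed

section \<open>Scalar recurrences for the step-sizes 1/(k+1)\<close>

text \<open>Multiplying \<open>step\<close> by \<open>k+1\<close> and inserting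
  \<open>G k \<ge> b k - H k\<close> turns the weight \<open>k+1\<close> of the old gap into
  \<open>k\<close>. The weighted gaps then telescope, up to a harmonic sum.\<close>

lemma averaging_bound_gap:
  fixes b H G :: "nat \<Rightarrow> real"
  assumes C: "0 \<le> C"
    and step: "\<And>k. H k + G k / (real k + 1) - C/2 / (real k + 1)\<^sup>2 \<le> H (Suc k)"
    and bound: "\<And>k. b k \<le> H k + G k"
    and dec: "\<And>k. b (Suc k) \<le> b k"
  shows "b k - H (Suc k) \<le> C/2 * (1 + ln (real k + 1)) / (real k + 1)"
proof -
  have scaled: "(real k + 1) * (b k - H (Suc k)) \<le> real k * (b k - H k) + C/2 / (real k + 1)" for k
  proof -
    have "c * (u + v / c - w / c\<^sup>2) = c * u + v - w / c" if "c \<noteq> 0" for c u v w :: real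
      using that by (simp add: field_simps power2_eq_square)
    from this[of "real k + 1"]
    have "(real k + 1) * (H k + G k / (real k + 1) - C/2 / (real k + 1)\<^sup>2)
        = (real k + 1) * H k + G k - C/2 / (real k + 1)"
      by fastforce
    moreover have "(real k + 1) * (H k + G k / (real k + 1) - C/2 / (real k + 1)\<^sup>2)
        \<le> (real k + 1) * H (Suc k)"
      using step[of k] by (intro mult_left_mono) auto
    ultimately show ?thesis using bound[of k] by (simp add: algebra_simps)
  qed
  have "(real k + 1) * (b k - H (Suc k)) \<le> C/2 * (1 + ln (real k + 1))"
  proof (induction k)
    case 0
    \<comment> \<open>The factor \<open>real k\<close> vanishes at \<open>k = 0\<close>, so no
      initial gap enters; this is the effect of the pre-start step.\<close>
    show ?case using scaled[of 0] by simp
  next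
    case (Suc k)
    have "ln ((real k + 1) / (real k + 2)) \<le> (real k + 1) / (real k + 2) - 1"
      by (rule ln_le_minus_one) simp
    then have "1 / (real k + 2) \<le> ln (real k + 2) - ln (real k + 1)"
      by (simp add: ln_div field_simps)
    then have "C/2 * (1 / (real k + 2)) \<le> C/2 * (ln (real k + 2) - ln (real k + 1))"
      using C by (intro mult_left_mono) auto
    then have log: "C/2 * (1 + ln (real k + 1)) + C/2 / (real k + 2) \<le> C/2 * (1 + ln (real k + 2))"
      by (simp only: distrib_left right_diff_distrib times_divide_eq_right mult_1_right)
    have "(real (Suc k) + 1) * (b (Suc k) - H (Suc (Suc k)))
        \<le> (real k + 1) * (b (Suc k) - H (Suc k)) + C/2 / (real k + 2)"
      using scaled[of "Suc k"] by (simp add: add.commute)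
    \<comment> \<open>Since the bounds only decrease, \<open>b (Suc k)\<close> may be replaced by
      \<open>b k\<close> to reach the induction hypothesis.\<close>
    also have "\<dots> \<le> (real k + 1) * (b k - H (Suc k)) + C/2 / (real k + 2)"
      using dec by (intro add_right_mono mult_left_mono) auto
    also have "\<dots> \<le> C/2 * (1 + ln (real k + 2))"
      using Suc log by linarith
    finally show ?case by (simp add: add.commute)
  qed
  moreover have "0 < real k + 1" by simp
  ultimately show ?thesis by (metis pos_le_divide_eq mult.commute)
qed

text \<open>This is \<open>step\<close> summed over \<open>m \<le> i \<le> k\<close> with each gap
  replaced by \<open>g\<close>. The step-sizes sum to at least the logarithm, and their squares to
  at most a telescoping difference.\<close>

lemma averaging_gap_sum:
  fixes H G :: "nat \<Rightarrow> real"
  assumes C: "0 \<le> C" and m: "1 \<le> m" "m \<le> k" and g: "0 \<le> g"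
    and step: "\<And>k. H k + G k / (real k + 1) - C/2 / (real k + 1)\<^sup>2 \<le> H (Suc k)"
    and le: "\<And>i. m \<le> i \<Longrightarrow> i \<le> k \<Longrightarrow> g \<le> G i"
  shows "g * ln ((real k + 2) / (real m + 1))
    \<le> H (Suc k) - H m + C/2 * (1 / real m - 1 / (real k + 1))"
proof -
  have incr: "g * (ln (real i + 2) - ln (real i + 1))
      \<le> H (Suc i) - H i + C/2 * (1 / real i - 1 / (real i + 1))" if i: "m \<le> i" "i \<le> k" for i
  proof -
    have "ln ((real i + 2) / (real i + 1)) \<le> (real i + 2) / (real i + 1) - 1"
      by (rule ln_le_minus_one) simp
    then have "ln (real i + 2) - ln (real i + 1) \<le> 1 / (real i + 1)"
      by (simp add: ln_div field_simps)
    then have "g * (ln (real i + 2) - ln (real i + 1)) \<le> g * (1 / (real i + 1))"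
      using g by (rule mult_left_mono)
    also have "\<dots> \<le> G i / (real i + 1)"
      using le[OF i] by (simp add: divide_right_mono)
    finally have 1: "g * (ln (real i + 2) - ln (real i + 1)) \<le> G i / (real i + 1)" .
    have "1 / (real i + 1)\<^sup>2 \<le> 1 / (real i * (real i + 1))"
      using i m(1) by (intro divide_left_mono) (auto simp: power2_eq_square)
    also have "\<dots> = 1 / real i - 1 / (real i + 1)"
      using i m(1) by (simp add: field_simps)
    finally have "1 / (real i + 1)\<^sup>2 \<le> 1 / real i - 1 / (real i + 1)" .
    then have "C/2 * (1 / (real i + 1)\<^sup>2) \<le> C/2 * (1 / real i - 1 / (real i + 1))"
      using C by (intro mult_left_mono) auto
    with 1 step[of i] show ?thesis by (simp only: times_divide_eq_right mult_1_right)
  qed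
  have "n \<le> k \<Longrightarrow> g * (ln (real n + 2) - ln (real m + 1))
      \<le> H (Suc n) - H m + C/2 * (1 / real m - 1 / (real n + 1))" if "m \<le> n" for n
    using that
  proof (induction rule: dec_induct)
    case base
    then show ?case using incr[of m] by simp
  next
    case (step n)
    then show ?case using incr[of "Suc n"] by (simp add: algebra_simps)
  qed
  from this[OF m(2)] show ?thesis by (simp add: ln_div)
qed

text \<open>Here \<open>g\<close> is any nonnegative common lower bound of the gaps; the minimum gap
  is inserted for it later.\<close>

lemma averaging_min_gap:
  fixes b H G :: "nat \<Rightarrow> real"
  assumes C: "0 \<le> C"
    and step: "\<And>k. H k + G k / (real k + 1) - C/2 / (real k + 1)\<^sup>2 \<le> H (Suc k)"
    and bound: "\<And>k. b k \<le> H k + G k"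
    and dec: "\<And>k. b (Suc k) \<le> b k"
    and upper: "\<And>i k. H i \<le> b k"
    and k: "2 \<le> k" and g: "0 \<le> g" and le: "\<And>i. 1 \<le> i \<Longrightarrow> i \<le> k \<Longrightarrow> g \<le> G i"
  shows "g \<le> 3/4 * C * (2.3 + 2 * ln (real k)) / (real k - 1)"
proof -
  \<comment> \<open>Halving makes \<open>(k+2)/(m+1) \<ge> 2\<close>, so the logarithm is at least
    \<open>ln 2\<close>, while \<open>1/m \<le> 2/(k-1)\<close> gives the denominator of the
    claim.\<close>
  define m where "m = k div 2"
  have m: "1 \<le> m" "m \<le> k" and mk: "2 * m \<le> k" and km: "k \<le> 2 * m + 1"
    using k by (auto simp: m_def)
  have mk': "2 * real m \<le> real k" and km': "real k - 1 \<le> 2 * real m" and k': "2 \<le> real k"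
    using mk km k by linarith+
  have ln2: "0.68 \<le> ln (2::real)"
    using ln_approx_bounds[of 2 2] by (simp add: eval_nat_numeral)
  \<comment> \<open>\<open>H (Suc k)\<close> is at most \<open>b (m - 1)\<close>, and the index
    \<open>m - 1\<close> is the one whose bound gap is measured at \<open>H m\<close>.\<close>
  have "H (Suc k) - H m \<le> C/2 * (1 + ln (real m)) / real m"
    using averaging_bound_gap[OF C step bound dec, of "m - 1"] upper[of "Suc k" "m - 1"] m(1)
    by (simp add: of_nat_diff)
  moreover have "g * ln 2 \<le> g * ln ((real k + 2) / (real m + 1))"
    using g mk' by (intro mult_left_mono ln_mono) (auto simp: field_simps)
  moreover have "g * ln ((real k + 2) / (real m + 1))
      \<le> H (Suc k) - H m + C/2 * (1 / real m - 1 / (real k + 1))"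
    using le m by (intro averaging_gap_sum[OF C m g step]) auto
  ultimately have "g * ln 2
      \<le> C/2 * (1 + ln (real m)) / real m + C/2 * (1 / real m - 1 / (real k + 1))"
    by linarith
  also have "\<dots> = C/2 * ((2 + ln (real m)) * (1 / real m) - 1 / (real k + 1))"
    by (simp add: algebra_simps add_divide_distrib diff_divide_distrib)
  finally have sum: "g * ln 2 \<le> \<dots>" .
  have "ln (real m) \<le> ln (real k / 2)" using m mk' by (intro ln_mono) auto
  then have lnm: "ln (real m) \<le> ln (real k) - ln 2" using k by (simp add: ln_div)
  have "(2 + ln (real m)) * (1 / real m) \<le> (2 + ln (real k) - ln 2) * (2 / (real k - 1))"
  proof (rule mult_mono)
    show "1 / real m \<le> 2 / (real k - 1)" using km' m k' by (simp add: field_simps)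
    show "0 \<le> 2 + ln (real k) - ln 2" using lnm m by (smt (verit) ln_ge_zero of_nat_1 of_nat_mono)
  qed (use lnm in auto)
  \<comment> \<open>This keeps part of the negative term \<open>- 1 / (real k + 1)\<close>, to be
    absorbed into the constant. The factor 1/6 is the largest possible, with equality at
    \<open>k = 2\<close>.\<close>
  moreover have "1 / 6 * (2 / (real k - 1)) \<le> 1 / (real k + 1)" if "2 \<le> real k"
    using that by (simp add: field_simps)
  \<comment> \<open>The numbers are 1.725 = 3/4 * 2.3 and 1.5 = 3/4 * 2. With
    \<open>ln 2 \<ge> 0.68\<close>, the coefficients of \<open>ln (real k)\<close> compare by
    \<open>1.5 * ln 2 \<ge> 1\<close>, and the constants by
    \<open>2 - 1/6 \<le> 2.725 * ln 2\<close>.\<close>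
  moreover have "2 + ln (real k) - ln 2 - 1/6 \<le> (1.725 + 1.5 * ln (real k)) * ln 2"
  proof -
    have "ln (real k) * 1 \<le> ln (real k) * (1.5 * ln 2)"
      using k ln2 by (intro mult_left_mono) auto
    then have "ln (real k) \<le> 1.5 * ln (real k) * ln 2" by simp
    then show ?thesis using ln2 by (simp add: algebra_simps)
  qed
  then have "(2 + ln (real k) - ln 2 - 1/6) * (2 / (real k - 1))
      \<le> (1.725 + 1.5 * ln (real k)) * ln 2 * (2 / (real k - 1))"
    using k' by (intro mult_right_mono) auto
  ultimately have "(2 + ln (real m)) * (1 / real m) - 1 / (real k + 1)
      \<le> (1.725 + 1.5 * ln (real k)) * ln 2 * (2 / (real k - 1))"
    using k' by (smt (verit) left_diff_distrib)
  then have "C/2 * ((2 + ln (real m)) * (1 / real m) - 1 / (real k + 1))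
      \<le> C/2 * ((1.725 + 1.5 * ln (real k)) * ln 2 * (2 / (real k - 1)))"
    using C by (intro mult_left_mono) auto
  with sum have "g * ln 2 \<le> C/2 * ((1.725 + 1.5 * ln (real k)) * ln 2 * (2 / (real k - 1)))"
    by linarith
  also have "\<dots> = 3/4 * C * (2.3 + 2 * ln (real k)) / (real k - 1) * ln 2"
  proof -
    have "1.725 + 1.5 * ln (real k) = 3/4 * (2.3 + 2 * ln (real k))" by simp
    moreover have "C/2 * (3/4 * u * v * (2 / w)) = 3/4 * C * u / w * v" for u v w :: real
      by simp
    ultimately show ?thesis by metis
  qed
  finally show ?thesis by (rule mult_right_le_imp_le) (use ln2 in simp)
qed

theorem mainTheorem4:
  fixes Q :: "'a::real_normed_vector set"
    and h :: "'a \<Rightarrow> real"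
    and dh :: "'a \<Rightarrow> 'a \<Rightarrow>\<^sub>L real"
    and \<alpha> :: "nat \<Rightarrow> real"
    and lam lamt :: "nat \<Rightarrow> 'a"
    and Binit :: ereal
    and Bo :: "nat \<Rightarrow> ereal"
  assumes fin_dim: "\<exists>S::'a set. finite S \<and> span S = UNIV"
    and Q: "Q \<noteq> {}" "convex Q" "compact Q"
    and concave: "concave_on Q h"
    and gradient: "is_gradient_on Q h dh"
    and curvature: "finite_curvature Q h dh"
    and Binit: "ereal (opt_value Q h) \<le> Binit"
    and Bo: "\<And>k. ereal (opt_value Q h) \<le> Bo k"
    and prestart: "fw_prestart Q h dh lam lamt"
    and run: "fw_method Q h dh \<alpha> lam lamt"
    and steps: "\<And>i. i \<ge> 1 \<Longrightarrow> \<alpha> i = 1 / (real i + 1)"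
  shows "(\<forall>k. best_bound h dh lam lamt Binit Bo k - ereal (h (lam (k + 1)))
              \<le> ereal (1/2 * curvature_const Q h dh * (1 + ln (real k + 1)) / (real k + 1)))
       \<and> (\<forall>k\<ge>2. Min (fw_gap dh lam lamt ` {1..k})
              \<le> 3/4 * curvature_const Q h dh * (2.3 + 2 * ln (real k)) / (real k - 1))"
proof -
  define C where "C = curvature_const Q h dh"
  define H where "H k = h (lam k)" for k
  define G where "G = fw_gap dh lam lamt"
  define B where "B = best_bound h dh lam lamt Binit Bo"
  define b where "b k = real_of_ereal (B k)" for k
  have C: "0 \<le> C" "curvature_bound Q h dh C"
    unfolding C_def by (rule curvature_const_is_bound[OF Q(1) curvature])+
  have lam: "lam k \<in> Q" for k
    by (rule fw_iterates_in_set[OF Q(2) prestart run]) (simp add: steps)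
  have argmax: "is_arg_max (lin_model h dh (lam k)) (\<lambda>y. y \<in> Q) (lamt k)" for k
    using prestart run by (cases "k = 0") (auto simp: fw_prestart_def fw_method_def)
  then have lamt: "lamt k \<in> Q" for k by (auto simp: is_arg_max_def)
  \<comment> \<open>At \<open>k = 0\<close> the formula has step-size 1 and reads
    \<open>lam 1 = lamt 0\<close>, so the pre-start step needs no separate treatment below.\<close>
  have next_iterate: "lam (Suc k) = lam k + (1 / (real k + 1)) *\<^sub>R (lamt k - lam k)" for k
    using prestart run steps[of k] by (cases "k = 0") (auto simp: fw_prestart_def fw_method_def)
  have step: "H k + G k / (real k + 1) - C/2 / (real k + 1)\<^sup>2 \<le> H (Suc k)" for k
  proof -
    have "h (lam k + (1 / (real k + 1)) *\<^sub>R (lamt k - lam k)) \<ge>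
        h (lam k) + blinfun_apply (dh (lam k)) ((1 / (real k + 1)) *\<^sub>R (lamt k - lam k))
          - 1/2 * C * (1 / (real k + 1))\<^sup>2"
      using C(2) lam lamt unfolding curvature_bound_def by (force intro: bspec)
    then show ?thesis
      by (simp add: H_def G_def fw_gap_def next_iterate blinfun.scaleR_right power_divide)
  qed
  have wolfe: "wolfe_bound h dh lam lamt k = H k + G k" for k
    by (simp add: wolfe_bound_def lin_model_def H_def G_def fw_gap_def)
  have opt_wolfe: "opt_value Q h \<le> wolfe_bound h dh lam lamt k" for k
    by (rule opt_value_le_wolfe_bound[OF concave gradient Q(1) lam argmax])
  have opt_B: "ereal (opt_value Q h) \<le> B k" for k
    unfolding B_def using Binit Bo opt_wolfe by (induction k) auto
  have B_wolfe: "B k \<le> ereal (H k + G k)" for k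
    unfolding B_def wolfe[symmetric] by (cases k) (auto simp: min_def)
  \<comment> \<open>\<open>B k\<close> lies between two finite values, so the passage to the reals
    loses nothing and the scalar lemmas apply.\<close>
  have B: "B k = ereal (b k)" for k
    unfolding b_def using opt_B[of k] B_wolfe[of k] by (cases "B k") auto
  have bound: "b k \<le> H k + G k" for k
    using B_wolfe[of k] by (simp add: B)
  have dec: "b (Suc k) \<le> b k" for k
  proof -
    have "B (Suc k) \<le> B k" by (simp add: B_def)
    then show ?thesis by (simp add: B)
  qed
  have upper: "H i \<le> b k" for i k
    using le_opt_value[OF Q(3) gradient lam[of i]] opt_B[of k] by (simp add: B H_def)
  \<comment> \<open>\<open>lam k\<close> itself competes in the maximization, and its linear term is
    zero.\<close>
  have G: "0 \<le> G k" for k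
    using argmax[of k] lam[of k]
    by (auto simp: is_arg_max_def lin_model_def G_def fw_gap_def blinfun.zero_right not_less)
  have "B k - ereal (H (k + 1))
      \<le> ereal (1/2 * C * (1 + ln (real k + 1)) / (real k + 1))" for k
    using averaging_bound_gap[OF C(1) step bound dec, of k] by (simp add: B)
  moreover have "Min (G ` {1..k}) \<le> 3/4 * C * (2.3 + 2 * ln (real k)) / (real k - 1)"
    if k: "2 \<le> k" for k
  proof (rule averaging_min_gap[OF C(1) step bound dec upper k])
    show "0 \<le> Min (G ` {1..k})" using k G by (subst Min_ge_iff) auto
  qed auto
  ultimately show ?thesis unfolding B_def H_def G_def C_def by blast
qed

end
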